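(* Let $\Phi=(\phi_j)_{j=1}^n$ be an $(a,b)$-equiangular system in a non-isotropic space $V$ (with $a,b\in\mathbb{F}_0$), let $d=\dim(\operatorname{im}\Phi)$, and suppose $\operatorname{Char}\mathbb{F}>d$ and $\frac{na}{d}\neq 0$ in $\mathbb{F}$. Then $\Phi:\mathbb{F}^n\to\operatorname{im}\Phi$ is an $(a,b,\frac{n}{d}a)$-equiangular tight frame (in particular $\operatorname{im}\Phi$ is non-isotropic) if and only if $(n-1)b=\frac{n-d}{d}a^2$ and $\sum_{\ell=1}^n\Delta(\phi_j,\phi_k,\phi_\ell)=\frac{nab}{d}$ for all $j\neq k$ in $[n]$.
   Context: $\mathbb{F}$ is a field with an involution $\sigma$ (a field automorphism $x\mapsto x^\sigma$ with $(x^\sigma)^\sigma=x$, possibly the identity), and $\mathbb{F}_0=\{x\in\mathbb{F}: x^\sigma=x\}$. A Hermitian scalar product on a finite-dimensional $\mathbb{F}$-vector space $V$ is a map $\langle\cdot,\cdot\rangle:V\times V\to\mathbb{F}$ that is linear in the second argument and satisfies $\langle u,v\rangle=\langle v,u\rangle^\sigma$; it is non-degenerate if $\langle u,w\rangle=0$ for all $w$ forces $u=0$. A non-isotropic space is a finite-dimensional space with a non-degenerate Hermitian scalar product; a subspace is non-isotropic if the restricted scalar product is non-degenerate. $\mathbb{F}^n$ carries $\langle x,y\rangle=\sum_i x_i^\sigma y_i$. For a sequence $\Phi=(\phi_j)_{j=1}^n$ in $V$, the synthesis operator is $\Phi:\mathbb{F}^n\to V$, $x\mapsto\sum_j x_j\phi_j$,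 and $\Phi^\dagger$ is its adjoint, so $\Phi^\dagger v=(\langle\phi_j,v\rangle)_j$. $\Phi$ is a $c$-tight frame for a non-isotropic subspace $U$ if its vectors span $U$ and $\Phi\Phi^\dagger u=cu$ for all $u\in U$. $\Phi$ is an $(a,b)$-equiangular system ($a,b\in\mathbb{F}_0$) if $\langle\phi_j,\phi_j\rangle=a$ for all $j$ and $\langle\phi_j,\phi_k\rangle\langle\phi_k,\phi_j\rangle=b$ for all $j\neq k$; it is an $(a,b,c)$-equiangular tight frame (ETF) for $U$ if it is moreover a $c$-tight frame for $U$. Triple products: $\Delta(\phi_j,\phi_k,\phi_\ell)=\langle\phi_j,\phi_k\rangle\langle\phi_k,\phi_\ell\rangle\langle\phi_\ell,\phi_j\rangle$. Integers and fractions of integers are interpreted in $\mathbb{F}$ via the canonical ring map $\mathbb{Z}\to\mathbb{F}$ (characteristic $0$ counts as larger than every integer). *)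

theory Defs
  imports "HOL-Analysis.Analysis"
begin

definition field_involution :: "('a::field \<Rightarrow> 'a) \<Rightarrow> bool" where
  "field_involution \<sigma> \<longleftrightarrow>
     \<sigma> 1 = 1 \<and> (\<forall>x y. \<sigma> (x + y) = \<sigma> x + \<sigma> y) \<and> (\<forall>x y. \<sigma> (x * y) = \<sigma> x * \<sigma> y) \<and>
     (\<forall>x. \<sigma> (\<sigma> x) = x)"

definition fixed_field :: "('a::field \<Rightarrow> 'a) \<Rightarrow> 'a set" where
  "fixed_field \<sigma> = {x. \<sigma> x = x}"

definition hermitian_product ::
    "('a::field \<Rightarrow> 'v::ab_group_add \<Rightarrow> 'v) \<Rightarrow> ('a \<Rightarrow> 'a) \<Rightarrow> ('v \<Rightarrow> 'v \<Rightarrow> 'a) \<Rightarrow> bool" where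
  "hermitian_product smul \<sigma> ip \<longleftrightarrow>
     (\<forall>u. Vector_Spaces.linear smul (*) (ip u)) \<and> (\<forall>u v. ip u v = \<sigma> (ip v u))"

definition nondegenerate_on :: "('v::ab_group_add \<Rightarrow> 'v \<Rightarrow> 'a::field) \<Rightarrow> 'v set \<Rightarrow> bool" where
  "nondegenerate_on ip U \<longleftrightarrow> (\<forall>u\<in>U. (\<forall>w\<in>U. ip u w = 0) \<longrightarrow> u = 0)"

text \<open>The whole type \<open>'v\<close> plays the role of the space \<open>V\<close>.\<close>

definition non_isotropic_space ::
    "('a::field \<Rightarrow> 'v::ab_group_add \<Rightarrow> 'v) \<Rightarrow> ('a \<Rightarrow> 'a) \<Rightarrow> ('v \<Rightarrow> 'v \<Rightarrow> 'a) \<Rightarrow> bool" where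
  "non_isotropic_space smul \<sigma> ip \<longleftrightarrow>
     (\<exists>B. finite_dimensional_vector_space smul B) \<and>
     hermitian_product smul \<sigma> ip \<and> nondegenerate_on ip UNIV"

definition non_isotropic_subspace ::
    "('a::field \<Rightarrow> 'v::ab_group_add \<Rightarrow> 'v) \<Rightarrow> ('v \<Rightarrow> 'v \<Rightarrow> 'a) \<Rightarrow> 'v set \<Rightarrow> bool" where
  "non_isotropic_subspace smul ip U \<longleftrightarrow> module.subspace smul U \<and> nondegenerate_on ip U"

definition coord_ip :: "('a::field \<Rightarrow> 'a) \<Rightarrow> 'a ^ 'n \<Rightarrow> 'a ^ 'n \<Rightarrow> 'a" where
  "coord_ip \<sigma> x y = (\<Sum>i\<in>UNIV. \<sigma> (x $ i) * y $ i)"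

definition synthesis ::
    "('a::field \<Rightarrow> 'v::ab_group_add \<Rightarrow> 'v) \<Rightarrow> ('n::finite \<Rightarrow> 'v) \<Rightarrow> 'a ^ 'n \<Rightarrow> 'v" where
  "synthesis smul \<phi> x = (\<Sum>j\<in>UNIV. smul (x $ j) (\<phi> j))"

text \<open>The adjoint of \<open>synthesis\<close> with respect to \<open>ip\<close> and \<open>coord_ip\<close>; see
  \<open>synthesis_adjoint_iff\<close> below.\<close>

definition analysis :: "('v \<Rightarrow> 'v \<Rightarrow> 'a::field) \<Rightarrow> ('n::finite \<Rightarrow> 'v) \<Rightarrow> 'v \<Rightarrow> 'a ^ 'n" where
  "analysis ip \<phi> v = (\<chi> j. ip (\<phi> j) v)"

definition tight_frame ::
    "('a::field \<Rightarrow> 'v::ab_group_add \<Rightarrow> 'v) \<Rightarrow> ('v \<Rightarrow> 'v \<Rightarrow> 'a) \<Rightarrow> 'a \<Rightarrow> 'v set \<Rightarrow>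
     ('n::finite \<Rightarrow> 'v) \<Rightarrow> bool" where
  "tight_frame smul ip c U \<phi> \<longleftrightarrow>
     non_isotropic_subspace smul ip U \<and> module.span smul (range \<phi>) = U \<and>
     (\<forall>u\<in>U. synthesis smul \<phi> (analysis ip \<phi> u) = smul c u)"

definition equiangular_system ::
    "('a::field \<Rightarrow> 'a) \<Rightarrow> ('v \<Rightarrow> 'v \<Rightarrow> 'a) \<Rightarrow> 'a \<Rightarrow> 'a \<Rightarrow> ('n::finite \<Rightarrow> 'v) \<Rightarrow> bool" where
  "equiangular_system \<sigma> ip a b \<phi> \<longleftrightarrow>
     a \<in> fixed_field \<sigma> \<and> b \<in> fixed_field \<sigma> \<and>
     (\<forall>j. ip (\<phi> j) (\<phi> j) = a) \<and>
     (\<forall>j k. j \<noteq> k \<longrightarrow> ip (\<phi> j) (\<phi> k) * ip (\<phi> k) (\<phi> j) = b)"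

definition equiangular_tight_frame ::
    "('a::field \<Rightarrow> 'v::ab_group_add \<Rightarrow> 'v) \<Rightarrow> ('a \<Rightarrow> 'a) \<Rightarrow> ('v \<Rightarrow> 'v \<Rightarrow> 'a) \<Rightarrow> 'a \<Rightarrow> 'a \<Rightarrow> 'a \<Rightarrow>
     'v set \<Rightarrow> ('n::finite \<Rightarrow> 'v) \<Rightarrow> bool" where
  "equiangular_tight_frame smul \<sigma> ip a b c U \<phi> \<longleftrightarrow>
     equiangular_system \<sigma> ip a b \<phi> \<and> tight_frame smul ip c U \<phi>"

definition triple_product :: "('v \<Rightarrow> 'v \<Rightarrow> 'a::field) \<Rightarrow> 'v \<Rightarrow> 'v \<Rightarrow> 'v \<Rightarrow> 'a" where
  "triple_product ip u v w = ip u v * ip v w * ip w u"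

lemma synthesis_adjoint_iff:
  fixes smul :: "'a::field \<Rightarrow> 'v::ab_group_add \<Rightarrow> 'v" and \<phi> :: "'n::finite \<Rightarrow> 'v"
  assumes inv: "field_involution \<sigma>" and herm: "hermitian_product smul \<sigma> ip"
  shows "(\<forall>x v. ip (synthesis smul \<phi> x) v = coord_ip \<sigma> x (g v)) \<longleftrightarrow> g = analysis ip \<phi>"
proof -
  have lin: "Vector_Spaces.linear smul (*) (ip u)" and conj: "ip u v = \<sigma> (ip v u)" for u v
    using herm unfolding hermitian_product_def by blast+
  have add: "\<sigma> (x + y) = \<sigma> x + \<sigma> y" and mult: "\<sigma> (x * y) = \<sigma> x * \<sigma> y" and one: "\<sigma> 1 = 1" for x y
    using inv unfolding field_involution_def by blast+
  have zero: "\<sigma> 0 = 0" by (metis add add.right_neutral add_left_cancel)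
  have sumsig: "\<sigma> (\<Sum>j\<in>A. f j) = (\<Sum>j\<in>A. \<sigma> (f j))" if "finite A" for A :: "'n set" and f
    using that by (induction) (simp_all add: zero add)
  have main: "ip (synthesis smul \<phi> x) v = coord_ip \<sigma> x (analysis ip \<phi> v)" for x v
  proof -
    interpret l: Vector_Spaces.linear smul "(*)" "ip v" by (rule lin)
    have "ip (synthesis smul \<phi> x) v = \<sigma> (\<Sum>j\<in>UNIV. x $ j * ip v (\<phi> j))"
      by (subst conj) (simp add: synthesis_def l.sum l.scale)
    also have "\<dots> = (\<Sum>j\<in>UNIV. \<sigma> (x $ j) * ip (\<phi> j) v)"
      by (simp add: sumsig mult conj[symmetric])
    finally show ?thesis by (simp add: coord_ip_def analysis_def)
  qed
  have coord: "coord_ip \<sigma> (axis i 1) y = y $ i" for i :: 'n and y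
  proof -
    have "coord_ip \<sigma> (axis i 1) y = (\<Sum>k\<in>UNIV. if k = i then y $ k else 0)"
      unfolding coord_ip_def by (rule sum.cong) (auto simp: axis_def zero one)
    then show ?thesis by simp
  qed
  have "g = analysis ip \<phi>" if "\<forall>x v. ip (synthesis smul \<phi> x) v = coord_ip \<sigma> x (g v)"
  proof
    fix v
    have "coord_ip \<sigma> x (g v) = coord_ip \<sigma> x (analysis ip \<phi> v)" for x
      using that main by metis
    then show "g v = analysis ip \<phi> v" by (metis coord vec_eq_iff)
  qed
  then show ?thesis using main by blast
qed

end

theory Submission
  imports Defs
begin

text \<open>
  Put \<open>c = na/d\<close> and let \<open>G\<close> be the Gram matrix of \<open>\<phi>\<close>. The two displayed conditions are the
  diagonal and the off-diagonal part of \<open>G\<^sup>2 = cG\<close>, the latter multiplied by the matching entry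
  of \<open>G\<close>, which vanishes only if \<open>b = 0\<close>. A tight frame clearly satisfies \<open>G\<^sup>2 = cG\<close>. Conversely,
  \<open>G\<^sup>2 = cG\<close> says that the frame operator \<open>T\<close> on \<open>U = im \<phi>\<close> acts as \<open>c\<close> modulo the radical \<open>R\<close>
  of \<open>U\<close>, and \<open>T\<close> vanishes on \<open>R\<close>. Computing the trace of \<open>T\<close> in a basis of \<open>U\<close> that extends a
  basis of \<open>R\<close> gives \<open>na = c (d - dim R)\<close>, so \<open>dim R = 0\<close> in the field, hence \<open>R = 0\<close> because the
  characteristic exceeds \<open>d\<close>.
\<close>

lemma of_nat_eq_0_imp_eq_0:
  assumes "of_nat m = (0::'a::semiring_1)" "m \<le> d" "CHAR('a) = 0 \<or> CHAR('a) > d"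
  shows "m = 0"
  using assms by (auto simp: of_nat_eq_0_iff_char_dvd dest: dvd_imp_le)

text \<open>Comparing diagonal entries of \<open>G\<^sup>2\<close> and \<open>cG\<close> gives the
  condition on \<open>b\<close>; off the diagonal, multiplying by the transposed entry of
  \<open>G\<close> turns the comparison into the one on triple products.\<close>

lemma gram_square_iff:
  fixes G :: "'n::finite \<Rightarrow> 'n \<Rightarrow> 'a::field"
  assumes \<sigma>0: "\<sigma> 0 = 0" and conj: "\<And>j k. G j k = \<sigma> (G k j)"
    and diag: "\<And>j. G j j = a" and off: "\<And>j k. j \<noteq> k \<Longrightarrow> G j k * G k j = b"
  shows "(\<forall>j k. (\<Sum>l\<in>UNIV. G j l * G l k) = c * G j k) \<longleftrightarrow>
    (of_nat CARD('n) - 1) * b = c * a - a\<^sup>2 \<and>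
    (\<forall>j k. j \<noteq> k \<longrightarrow> (\<Sum>l\<in>UNIV. G j k * G k l * G l j) = c * b)"
proof -
  have sq: "(\<Sum>l\<in>UNIV. G j l * G l j) = a\<^sup>2 + (of_nat CARD('n) - 1) * b" for j
  proof -
    have "(\<Sum>l\<in>UNIV. G j l * G l j) = G j j * G j j + (\<Sum>l\<in>UNIV - {j}. G j l * G l j)"
      by (rule sum.remove) auto
    also have "(\<Sum>l\<in>UNIV - {j}. G j l * G l j) = (\<Sum>l\<in>UNIV - {j}. b)"
      by (rule sum.cong) (auto intro: off)
    also have "\<dots> = (of_nat CARD('n) - 1) * b"
      by (simp add: card_Diff_singleton of_nat_diff Suc_leI)
    finally show ?thesis by (simp add: diag power2_eq_square)
  qed
  have triple: "(\<Sum>l\<in>UNIV. G j k * G k l * G l j) = G j k * (\<Sum>l\<in>UNIV. G k l * G l j)" for j k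
    by (simp add: sum_distrib_left mult.assoc)
  \<comment> \<open>The factor \<open>G j k\<close> comes out of the sum, leaving the
    \<open>(k, j)\<close> entry of the square: the indices are swapped.\<close>
  have offdiag: "(\<Sum>l\<in>UNIV. G j k * G k l * G l j) = c * b \<longleftrightarrow>
      (\<Sum>l\<in>UNIV. G k l * G l j) = c * G k j" if "j \<noteq> k" for j k
  proof (cases "b = 0")
    case True
    \<comment> \<open>One of \<open>G x y\<close> and \<open>G y x\<close> vanishes, and conjugation
      carries the zero to the other. So \<open>G\<close> is diagonal and both sides of the
      equivalence hold.\<close>
    have zero: "G x y = 0" if "x \<noteq> y" for x y
      using off[OF that] True \<sigma>0 conj[of x y] by auto
    have "(\<Sum>l\<in>UNIV. G k l * G l j) = 0"
    proof (rule sum.neutral, intro ballI)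
      show "G k l * G l j = 0" for l using zero \<open>j \<noteq> k\<close> by (cases "l = k") auto
    qed
    then show ?thesis using True zero that by (simp add: triple)
  next
    case False
    then have "G j k \<noteq> 0" using off[OF that] by auto
    moreover have "c * b = G j k * (c * G k j)" using off[OF that] by (simp add: ac_simps)
    ultimately show ?thesis unfolding triple by (metis mult_left_cancel)
  qed
  show ?thesis
  proof (intro iffI conjI allI impI)
    assume *: "\<forall>j k. (\<Sum>l\<in>UNIV. G j l * G l k) = c * G j k"
    \<comment> \<open>All diagonal entries give the same equation, so an arbitrary index
      suffices.\<close>
    show "(of_nat CARD('n) - 1) * b = c * a - a\<^sup>2"
      using *[rule_format, of undefined undefined] unfolding sq diag by (simp add: algebra_simps)
    show "(\<Sum>l\<in>UNIV. G j k * G k l * G l j) = c * b" if "j \<noteq> k" for j k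
      using * offdiag[OF that] by simp
  next
    fix j k
    assume *: "(of_nat CARD('n) - 1) * b = c * a - a\<^sup>2 \<and>
      (\<forall>j k. j \<noteq> k \<longrightarrow> (\<Sum>l\<in>UNIV. G j k * G k l * G l j) = c * b)"
    show "(\<Sum>l\<in>UNIV. G j l * G l k) = c * G j k"
    proof (cases "j = k")
      case True
      then show ?thesis using * by (simp add: sq diag)
    next
      case False
      then show ?thesis using * offdiag[of k j] by simp
    qed
  qed
qed

context vector_space
begin

text \<open>Links the image of the synthesis operator, used in the theorem, to the span that
  \<open>tight_frame\<close> refers to.\<close>

lemma range_synthesis:
  fixes \<phi> :: "'n::finite \<Rightarrow> 'b"
  shows "range (synthesis scale \<phi>) = span (range \<phi>)"
proof
  show "range (synthesis scale \<phi>) \<subseteq> span (range \<phi>)"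
    by (auto simp: synthesis_def intro!: span_sum span_scale intro: span_base)
  have "subspace (range (synthesis scale \<phi>))"
  proof (rule subspaceI)
    have "synthesis scale \<phi> 0 = 0" by (simp add: synthesis_def)
    then show "0 \<in> range (synthesis scale \<phi>)" by (metis rangeI)
  next
    fix u v assume "u \<in> range (synthesis scale \<phi>)" "v \<in> range (synthesis scale \<phi>)"
    then obtain x y where "u = synthesis scale \<phi> x" "v = synthesis scale \<phi> y" by auto
    then have "u + v = synthesis scale \<phi> (x + y)"
      by (simp add: synthesis_def scale_left_distrib sum.distrib)
    then show "u + v \<in> range (synthesis scale \<phi>)" by simp
  next
    fix r u assume "u \<in> range (synthesis scale \<phi>)"
    then obtain x where "u = synthesis scale \<phi> x" by auto
    then have "scale r u = synthesis scale \<phi> (\<chi> j. r * x $ j)"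
      by (simp add: synthesis_def scale_sum_right)
    then show "scale r u \<in> range (synthesis scale \<phi>)" by simp
  qed
  moreover have "\<phi> j \<in> range (synthesis scale \<phi>)" for j
  proof -
    have "synthesis scale \<phi> (axis j 1) = (\<Sum>k\<in>UNIV. if k = j then \<phi> k else 0)"
      unfolding synthesis_def by (rule sum.cong) (auto simp: axis_def)
    then show ?thesis by (metis (no_types) UNIV_I finite rangeI sum.delta)
  qed
  ultimately show "span (range \<phi>) \<subseteq> range (synthesis scale \<phi>)"
    by (intro span_minimal) auto
qed

text \<open>The map sending \<open>v\<close> to \<open>scale (f j v) (\<phi> j)\<close> has rank at
  most one and trace \<open>f j (\<phi> j)\<close>: expand \<open>\<phi> j\<close> in
  \<open>B\<close> and apply \<open>f j\<close>. The trace is written out as the sum of diagonal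
  coordinates.\<close>

lemma trace_sum_rank_one:
  assumes B: "finite B" "independent B"
    and \<phi>: "\<And>j. j \<in> J \<Longrightarrow> \<phi> j \<in> span B"
    and f: "\<And>j. j \<in> J \<Longrightarrow> Vector_Spaces.linear scale (*) (f j)"
  shows "(\<Sum>v\<in>B. representation B (\<Sum>j\<in>J. scale (f j v) (\<phi> j)) v) = (\<Sum>j\<in>J. f j (\<phi> j))"
proof -
  have "(\<Sum>v\<in>B. representation B (\<Sum>j\<in>J. scale (f j v) (\<phi> j)) v) =
      (\<Sum>v\<in>B. \<Sum>j\<in>J. f j v * representation B (\<phi> j) v)"
    by (intro sum.cong refl)
      (simp add: representation_sum[OF B(2)] representation_scale[OF B(2)] span_scale \<phi>)
  also have "\<dots> = (\<Sum>j\<in>J. \<Sum>v\<in>B. f j v * representation B (\<phi> j) v)"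
    by (rule sum.swap)
  also have "\<dots> = (\<Sum>j\<in>J. f j (\<phi> j))"
  proof (rule sum.cong[OF refl])
    fix j assume j: "j \<in> J"
    interpret l: Vector_Spaces.linear scale "(*)" "f j" using f[OF j] .
    have "f j (\<phi> j) = f j (\<Sum>v\<in>B. scale (representation B (\<phi> j) v) v)"
      using sum_representation_eq[OF B(2) \<phi>[OF j] B(1)] by simp
    then show "(\<Sum>v\<in>B. f j v * representation B (\<phi> j) v) = f j (\<phi> j)"
      by (simp add: l.sum l.scale mult.commute)
  qed
  finally show ?thesis .
qed

end

lemma tight_frame_iff_gram_square:
  fixes smul :: "'a::field \<Rightarrow> 'v::ab_group_add \<Rightarrow> 'v" and \<phi> :: "'n::finite \<Rightarrow> 'v"
  assumes vs: "vector_space smul" and herm: "hermitian_product smul \<sigma> ip" and \<sigma>0: "\<sigma> 0 = 0"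
    and d: "d = vector_space.dim smul (module.span smul (range \<phi>))"
    and char: "CHAR('a) = 0 \<or> CHAR('a) > d"
    and c: "c \<noteq> 0" "(\<Sum>j\<in>UNIV. ip (\<phi> j) (\<phi> j)) = c * of_nat d"
  shows "tight_frame smul ip c (module.span smul (range \<phi>)) \<phi> \<longleftrightarrow>
    (\<forall>j k. (\<Sum>l\<in>UNIV. ip (\<phi> j) (\<phi> l) * ip (\<phi> l) (\<phi> k)) = c * ip (\<phi> j) (\<phi> k))"
    (is "_ \<longleftrightarrow> ?gram")
proof -
  interpret vector_space smul by (rule vs)
  have lin: "Vector_Spaces.linear smul (*) (ip u)" and conj: "ip u v = \<sigma> (ip v u)" for u v
    using herm unfolding hermitian_product_def by blast+
  interpret l: Vector_Spaces.linear smul "(*)" "ip u" for u by (rule lin)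
  define T where "T u = (\<Sum>j\<in>UNIV. smul (ip (\<phi> j) u) (\<phi> j))" for u
  have T: "synthesis smul \<phi> (analysis ip \<phi> u) = T u" for u
    by (simp add: synthesis_def analysis_def T_def)
  have ipT: "ip u (T v) = (\<Sum>l\<in>UNIV. ip u (\<phi> l) * ip (\<phi> l) v)" for u v
    by (simp add: T_def l.sum l.scale mult.commute)
  define U where "U = span (range \<phi>)"
  have \<phi>U: "\<phi> j \<in> U" for j by (simp add: U_def span_base)
  have sub: "subspace U" by (simp add: U_def)
  have TU: "T u \<in> U" for u
    unfolding T_def by (intro subspace_sum subspace_scale sub \<phi>U)
  show ?thesis unfolding U_def[symmetric]
  proof
    assume "tight_frame smul ip c U \<phi>"
    then have "T (\<phi> k) = smul c (\<phi> k)" for k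
      using \<phi>U by (auto simp: tight_frame_def T)
    then show ?gram by (metis ipT l.scale)
  next
    assume gram: ?gram
    \<comment> \<open>As the \<open>\<phi> j\<close> span \<open>U\<close>, this is the radical of
      \<open>U\<close>.\<close>
    define R where "R = {u \<in> U. \<forall>j. ip (\<phi> j) u = 0}"
    have subR: "subspace R"
      using sub by (auto simp: R_def subspace_def l.add l.scale l.zero)
    \<comment> \<open>For \<open>u = \<phi> k\<close> this is the Gram identity paired with
      \<open>\<phi> j\<close>; linearity extends it to the span.\<close>
    have TR: "T u - smul c u \<in> R" if "u \<in> U" for u
    proof -
      have "ip (\<phi> j) (T u) = c * ip (\<phi> j) u" for j
        using that unfolding U_def
      proof (induction rule: span_induct_alt)
        case base
        then show ?case by (simp add: ipT l.zero)
      next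
        case (step r v w)
        then obtain k where "v = \<phi> k" by auto
        then have "(\<Sum>l\<in>UNIV. ip (\<phi> j) (\<phi> l) * ip (\<phi> l) v) = c * ip (\<phi> j) v"
          using gram by simp
        with step show ?case
          by (simp add: ipT l.add l.scale algebra_simps sum.distrib flip: sum_distrib_left)
      qed
      then show ?thesis
        using that sub by (simp add: R_def l.diff l.scale TU subspace_diff subspace_scale)
    qed
    obtain C where C: "C \<subseteq> R" "independent C" "R \<subseteq> span C"
      using maximal_independent_subset by blast
    have spanC: "span C = R" using C subR by (simp add: span_minimal subset_antisym)
    have "C \<subseteq> U" using C by (auto simp: R_def)
    then obtain B where B: "C \<subseteq> B" "B \<subseteq> U" "independent B" "U \<subseteq> span B"
      using maximal_independent_subset_extend[OF _ C(2)] by blast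
    have spanB: "span B = U" using B sub by (simp add: span_minimal subset_antisym)
    have finB: "finite B"
      by (rule independent_span_bound[of "range \<phi>", THEN conjunct1]) (use B U_def in auto)
    have cardB: "card B = d"
      using dim_eq_card[of B "span (range \<phi>)"] B spanB d by (simp add: U_def span_span)
    \<comment> \<open>On \<open>C\<close> the coefficients defining \<open>T v\<close> all vanish.
      For \<open>v\<close> outside \<open>C\<close>, the vector \<open>T v - smul c v\<close> lies
      in \<open>span C\<close>, so its coordinate at \<open>v\<close> is zero and that of
      \<open>T v\<close> is \<open>c\<close>.\<close>
    have coord: "representation B (T v) v = (if v \<in> C then 0 else c)" if "v \<in> B" for v
    proof (cases "v \<in> C")
      case True
      then have "T v = 0" using C by (auto simp: T_def R_def)
      then show ?thesis using True by (simp add: representation_zero)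
    next
      case False
      have vU: "v \<in> U" using that B by auto
      have "representation B (T v - smul c v) v = 0"
        using representation_extend[OF B(3) _ B(1), of "T v - smul c v"] TR[OF vU] spanC False
          representation_ne_zero[of C "T v - smul c v" v] by auto
      moreover have "representation B (T v - smul c v) v = representation B (T v) v - c"
        using vU TU sub that spanB
        by (simp add: representation_diff[OF B(3)] representation_scale[OF B(3)]
            representation_basis[OF B(3)] subspace_scale)
      ultimately show ?thesis using False by simp
    qed
    have cardC: "card C \<le> d" using B finB cardB card_mono by blast
    \<comment> \<open>The trace of \<open>T\<close> on \<open>U\<close> is computed twice: from the
      rank-one summands, then from the diagonal coordinates in \<open>B\<close>.\<close>
    have "c * of_nat d = (\<Sum>v\<in>B. representation B (T v) v)"
      using trace_sum_rank_one[OF finB B(3), of UNIV \<phi> "\<lambda>j. ip (\<phi> j)"] lin \<phi>U spanB c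
      by (simp add: T_def)
    also have "\<dots> = (\<Sum>v\<in>B - C. c)"
      by (intro sum.mono_neutral_cong_right) (auto simp: coord finB)
    also have "\<dots> = c * (of_nat d - of_nat (card C))"
      using B finB cardB cardC
      by (simp add: card_Diff_subset finite_subset of_nat_diff mult.commute)
    finally have "of_nat (card C) = (0::'a)" using c by (simp add: right_diff_distrib)
    then have "card C = 0" by (rule of_nat_eq_0_imp_eq_0[OF _ cardC char])
    then have "C = {}" using finite_subset[OF B(1) finB] by simp
    then have R0: "R = {0}" using spanC by auto
    have "nondegenerate_on ip U"
      unfolding nondegenerate_on_def
    proof (intro ballI impI)
      fix u assume "u \<in> U" "\<forall>w\<in>U. ip u w = 0"
      \<comment> \<open>Conjugation moves the vanishing from \<open>ip u (\<phi> j)\<close> to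
        \<open>ip (\<phi> j) u\<close>.\<close>
      then have "u \<in> R" using \<phi>U \<sigma>0 conj[of "\<phi> _" u] by (auto simp: R_def)
      then show "u = 0" using R0 by simp
    qed
    then show "tight_frame smul ip c U \<phi>"
      using sub TR R0 by (simp add: tight_frame_def non_isotropic_subspace_def T U_def)
  qed
qed

theorem theorem5p16:
  fixes smul :: "'a::field \<Rightarrow> 'v::ab_group_add \<Rightarrow> 'v"
    and \<sigma> :: "'a \<Rightarrow> 'a"
    and ip :: "'v \<Rightarrow> 'v \<Rightarrow> 'a"
    and \<phi> :: "'n::finite \<Rightarrow> 'v"
    and a b :: 'a and n d :: nat
  assumes "field_involution \<sigma>"
    and "non_isotropic_space smul \<sigma> ip"
    and "equiangular_system \<sigma> ip a b \<phi>"
    and "n = CARD('n)"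
    and "d = vector_space.dim smul (range (synthesis smul \<phi>))"
    and "CHAR('a) = 0 \<or> CHAR('a) > d"
    and "of_nat n * a / of_nat d \<noteq> 0"
  shows "equiangular_tight_frame smul \<sigma> ip a b (of_nat n / of_nat d * a)
           (range (synthesis smul \<phi>)) \<phi> \<longleftrightarrow>
         (of_nat n - 1) * b = (of_nat n - of_nat d) / of_nat d * a\<^sup>2 \<and>
         (\<forall>j k. j \<noteq> k \<longrightarrow>
            (\<Sum>l\<in>UNIV. triple_product ip (\<phi> j) (\<phi> k) (\<phi> l)) = of_nat n * a * b / of_nat d)"
proof -
  have herm: "hermitian_product smul \<sigma> ip" and "\<exists>B. finite_dimensional_vector_space smul B"
    using assms(2) by (auto simp: non_isotropic_space_def)
  then have vs: "vector_space smul"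
    by (auto simp: finite_dimensional_vector_space_def)
  have conj: "ip u v = \<sigma> (ip v u)" for u v
    using herm unfolding hermitian_product_def by blast
  have \<sigma>0: "\<sigma> 0 = 0"
    using assms(1) unfolding field_involution_def by (metis add.right_neutral add_left_cancel)
  have diag: "ip (\<phi> j) (\<phi> j) = a" and off: "j \<noteq> k \<Longrightarrow> ip (\<phi> j) (\<phi> k) * ip (\<phi> k) (\<phi> j) = b" for j k
    using assms(3) by (auto simp: equiangular_system_def)
  note range = vector_space.range_synthesis[OF vs, of \<phi>]
  define c where "c = of_nat n / of_nat d * a"
  \<comment> \<open>Division by zero yields zero, so the nonvanishing quotient also forces its
    denominator to be nonzero.\<close>
  have d0: "(of_nat d :: 'a) \<noteq> 0" and c0: "c \<noteq> 0" using assms(7) by (auto simp: c_def)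
  have trace: "(\<Sum>j\<in>UNIV. ip (\<phi> j) (\<phi> j)) = c * of_nat d"
    using d0 by (simp add: diag c_def assms(4))
  \<comment> \<open>Equiangularity is given, so only tightness has to be characterised.\<close>
  have "equiangular_tight_frame smul \<sigma> ip a b c (range (synthesis smul \<phi>)) \<phi> \<longleftrightarrow>
      (\<forall>j k. (\<Sum>l\<in>UNIV. ip (\<phi> j) (\<phi> l) * ip (\<phi> l) (\<phi> k)) = c * ip (\<phi> j) (\<phi> k))"
    using tight_frame_iff_gram_square[OF vs herm \<sigma>0 _ assms(6) c0 trace] assms(3,5)
    by (simp add: equiangular_tight_frame_def range)
  also have "\<dots> \<longleftrightarrow> (of_nat n - 1) * b = c * a - a\<^sup>2 \<and>
      (\<forall>j k. j \<noteq> k \<longrightarrow> (\<Sum>l\<in>UNIV. triple_product ip (\<phi> j) (\<phi> k) (\<phi> l)) = c * b)"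
    using gram_square_iff[of \<sigma> "\<lambda>j k. ip (\<phi> j) (\<phi> k)", OF \<sigma>0 conj diag off]
    by (simp add: triple_product_def assms(4))
  also have "c * a - a\<^sup>2 = (of_nat n - of_nat d) / of_nat d * a\<^sup>2"
    using d0 by (simp add: c_def field_simps power2_eq_square)
  also have "c * b = of_nat n * a * b / of_nat d"
    by (simp add: c_def)
  finally show ?thesis by (simp add: c_def)
qed

end
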